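(* For every $k\in\omega$, the poset $P_k$ (defined in the context) is not $3$-representable.
   Context: Representability: let $\alpha,\beta$ be cardinals. A poset $P$ is $(\alpha,\beta)$-representable if there is a field of sets $F$ (a family of subsets of some set $X$ closed under finite unions, finite intersections and complements in $X$) and a one-to-one map $h:P\to F$ such that: (1) whenever $S\subseteq P$ with $|S|<\alpha$ and $\bigwedge S$ exists in $P$, then $h(\bigwedge S)=\bigcap h[S]$; (2) whenever $T\subseteq P$ with $|T|<\beta$ and $\bigvee T$ exists in $P$, then $h(\bigvee T)=\bigcup h[T]$. "$\alpha$-representable" means $(\alpha,\alpha)$-representable. The posets $P_k$: define sets $N_n$ ($n\in\omega$) recursively by $N_0=\{a,b,c,d\}$ (four distinct elements) and $N_{n+1}=\{e_{xy}: x,y \text{ distinct elements of } N_n\}$, with one element $e_{xy}=e_{yx}$ for each unordered pair of distinct elements of $N_n$. Let $\widehat N_n=\bigcup_{x\in N_n}\{x',x''\}$, where $x',x''$ are two new elements for each $x$. Differently labeled elements are distinct. For $k\in\omega$, the carrier of $P_k$ is $\{p,q\}\cup\bigcup_{n=0}^k N_n\cup\bigcup_{n=0}^k\widehat N_n$, and its order is: (1) $x<p$ for all $x\in N_0$; (2) $x<x'$ and $x<x''$ for all $x\in N_n$, $n\le k$; (3) for $1\le n\le k$ and distinct $x,y\in N_{n-1}$, $e_{xy}<x'$, $e_{xy}<x''$, $e_{xy}<y'$, $e_{xy}<y''$; (4) $q<x'$ and $q<x''$ for all $x\in N_k$; (5) $x\le x$ for all $x\in P_k$; (6) no other elements are comparable.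 *)

theory Defs
  imports "HOL-Analysis.Sigma_Algebra" "HOL-Algebra.Order" "HOL-Library.Uprod"
begin

unbundle cardinal_syntax

text \<open>
  Cardinals are cardinal orders, possibly on different types; \<open>|S| <o \<alpha>\<close> says that
  the cardinality of \<open>S\<close> is less than \<open>\<alpha>\<close>. A field of sets on \<open>X\<close> is an \<open>algebra X F\<close>.
  The empty intersection is taken inside \<open>X\<close>. HOL cannot quantify over types within a
  formula, so the type \<open>'x\<close> of points is a parameter: a poset is not representable
  if it is not representable over \<open>'x\<close> for every type \<open>'x\<close>.
\<close>

definition representable2 ::
    "'x itself \<Rightarrow> 'c rel \<Rightarrow> 'd rel \<Rightarrow> 'a gorder \<Rightarrow> bool" where
  "representable2 _ \<alpha> \<beta> P \<longleftrightarrow>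
    (\<exists>(X :: 'x set) F h.
      algebra X F \<and> h \<in> carrier P \<rightarrow> F \<and> inj_on h (carrier P) \<and>
      (\<forall>S m. S \<subseteq> carrier P \<and> |S| <o \<alpha> \<and> is_glb P m S \<longrightarrow> h m = X \<inter> \<Inter> (h ` S)) \<and>
      (\<forall>T j. T \<subseteq> carrier P \<and> |T| <o \<beta> \<and> is_lub P j T \<longrightarrow> h j = \<Union> (h ` T)))"

definition representable :: "'x itself \<Rightarrow> 'c rel \<Rightarrow> 'a gorder \<Rightarrow> bool" where
  "representable X \<alpha> P \<longleftrightarrow> representable2 X \<alpha> \<alpha> P"

lemma card_of_less_lessThan: "|S| <o |{..<n :: nat}| \<longleftrightarrow> finite S \<and> card S < n"
proof
  assume less: "|S| <o |{..<n}|"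
  then have fin: "finite S"
    by (meson card_of_ordLeq_finite finite_lessThan ordLess_imp_ordLeq)
  moreover have "\<not> n \<le> card S"
  proof
    assume "n \<le> card S"
    then have "\<exists>f. inj_on f {..<n} \<and> f ` {..<n} \<subseteq> S"
      using fin card_le_inj[of "{..<n}" S] by auto
    then show False
      using less card_of_ordLeq[of "{..<n}" S] not_ordLess_ordLeq by blast
  qed
  ultimately show "finite S \<and> card S < n" by simp
next
  assume S: "finite S \<and> card S < n"
  have "\<not> (\<exists>f. inj_on f {..<n} \<and> f ` {..<n} \<subseteq> S)"
    using S card_inj_on_le[of _ "{..<n}" S] by fastforce
  then show "|S| <o |{..<n}|"
    using card_of_ordLess by blast
qed

text \<open>
  \<open>edge (Upair x y)\<close> is the element $e_{xy} = e_{yx}$; as \<open>edge\<close> is a constructor, elements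
  with different labels are distinct.
\<close>

datatype node = node_a | node_b | node_c | node_d | edge "node uprod"

fun Nset :: "nat \<Rightarrow> node set" where
  "Nset 0 = {node_a, node_b, node_c, node_d}"
| "Nset (Suc n) = {edge (Upair x y) | x y. x \<in> Nset n \<and> y \<in> Nset n \<and> x \<noteq> y}"

text \<open>\<open>Node x\<close>, \<open>Prime x\<close>, \<open>Dprime x\<close> are $x$, $x'$, $x''$.\<close>

datatype elem = elem_p | elem_q | Node node | Prime node | Dprime node

definition Nhat :: "nat \<Rightarrow> elem set" where
  "Nhat n = (\<Union>x\<in>Nset n. {Prime x, Dprime x})"

inductive Pless :: "nat \<Rightarrow> elem \<Rightarrow> elem \<Rightarrow> bool" for k :: nat where
  below_p: "x \<in> Nset 0 \<Longrightarrow> Pless k (Node x) elem_p"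
| below_own: "n \<le> k \<Longrightarrow> x \<in> Nset n \<Longrightarrow> u \<in> {Prime x, Dprime x} \<Longrightarrow> Pless k (Node x) u"
| edge_below: "1 \<le> n \<Longrightarrow> n \<le> k \<Longrightarrow> x \<in> Nset (n - 1) \<Longrightarrow> y \<in> Nset (n - 1) \<Longrightarrow> x \<noteq> y \<Longrightarrow>
    u \<in> {Prime x, Dprime x, Prime y, Dprime y} \<Longrightarrow> Pless k (Node (edge (Upair x y))) u"
| q_below: "x \<in> Nset k \<Longrightarrow> u \<in> {Prime x, Dprime x} \<Longrightarrow> Pless k elem_q u"

definition Pposet :: "nat \<Rightarrow> elem gorder" where
  "Pposet k =
    \<lparr>carrier = {elem_p, elem_q} \<union> (\<Union>n\<le>k. Node ` Nset n) \<union> (\<Union>n\<le>k. Nhat n),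
     eq = (=),
     le = (\<lambda>x y. x = y \<or> Pless k x y)\<rparr>"

lemma Pless_not_Pless: "Pless k x y \<Longrightarrow> \<not> Pless k y z"
  by (auto elim!: Pless.cases)

lemma Pless_carrier: "Pless k x y \<Longrightarrow> x \<in> carrier (Pposet k) \<and> y \<in> carrier (Pposet k)"
proof (induction rule: Pless.induct)
  case (edge_below n x y u)
  then have "edge (Upair x y) \<in> Nset n" "n - 1 \<le> k" by (cases n; auto)+
  with edge_below show ?case by (fastforce simp: Pposet_def Nhat_def)
qed (fastforce simp: Pposet_def Nhat_def simp del: Nset.simps)+

lemma partial_order_Pposet: "partial_order (Pposet k)"
  by unfold_locales (auto simp: Pposet_def dest: Pless_not_Pless)

end

theory Submission
  imports Defs
begin

text \<open>
  Fix a point \<open>t\<close> of \<open>h p\<close> and let \<open>G\<close> be the set of elements whose image contains \<open>t\<close>.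
  Any two members of \<open>N\<^sub>0\<close> have join \<open>p\<close>, so \<open>G\<close> contains three of them. For distinct
  \<open>x, y \<in> N\<^sub>n\<close> the meet of \<open>x'\<close> and \<open>y'\<close> is \<open>e\<^sub>x\<^sub>y\<close>, or \<open>q\<close> if \<open>n = k\<close>; a triangle has three edges,
  so \<open>G\<close> contains three members of every \<open>N\<^sub>n\<close>, and finally \<open>q\<close>. Hence \<open>x' \<in> G\<close> for all
  \<open>x \<in> N\<^sub>k\<close>. This descends: if \<open>x \<in> N\<^sub>n\<close> and \<open>u \<in> N\<^sub>n \<inter> G\<close> differs from \<open>x\<close>, then \<open>e\<^sub>u\<^sub>x\<close> is the
  meet of \<open>e\<^sub>u\<^sub>x'\<close> and \<open>u'\<close>, so it lies in \<open>G\<close>, and so does \<open>x'\<close> above it. At level 0,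
  \<open>a\<close> is the meet of \<open>a'\<close> and \<open>p\<close>, so \<open>a \<in> G\<close>. Thus \<open>h p = h a\<close>, and \<open>h\<close> is not injective.
\<close>

section \<open>Levels, and what lies below a primed element\<close>

lemma Nset_disjoint: "x \<in> Nset m \<Longrightarrow> x \<in> Nset n \<Longrightarrow> m = n"
proof (induction m arbitrary: n x)
  case 0
  then show ?case by (cases n) auto
next
  case (Suc m)
  then obtain u v where "x = edge (Upair u v)" "u \<in> Nset m" by auto
  with Suc show ?case by (cases n) auto
qed

lemma edge_in_Nset:
  "x \<in> Nset n \<Longrightarrow> y \<in> Nset n \<Longrightarrow> x \<noteq> y \<Longrightarrow> edge (Upair x y) \<in> Nset (Suc n)"
  by auto

declare Nset.simps(2) [simp del]

lemma edge_neq: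
  assumes "x \<in> Nset n" "y \<in> Nset n" "z \<in> Nset n" "x \<noteq> y"
  shows "edge (Upair x y) \<noteq> z"
  using edge_in_Nset[of x n y] Nset_disjoint[of z n "Suc n"] assms by auto

text \<open>The level of \<open>x\<close> decides which kinds of lower elements occur: edges at
  \<open>x\<close> only for \<open>n < k\<close>, and \<open>elem_q\<close> only for
  \<open>n = k\<close>. Every meet below is found by comparing two such lists.\<close>

lemma Pless_PrimeE:
  assumes "Pless k l (Prime x)" "x \<in> Nset n"
  obtains "l = Node x"
  | y where "n < k" "y \<in> Nset n" "x \<noteq> y" "l = Node (edge (Upair x y))"
  | "l = elem_q" "n = k"
  using assms(1)
proof cases
  case (edge_below m u v)
  have "x = u \<or> x = v"
    using edge_below by auto
  then obtain y where y: "x \<in> Nset (m - 1)" "y \<in> Nset (m - 1)" "x \<noteq> y" "Upair u v = Upair x y"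
    using edge_below by (metis Upair_inject)
  moreover from y(1) have "m - 1 = n"
    using assms(2) by (rule Nset_disjoint)
  ultimately show ?thesis
    using edge_below(1,2,3) by (intro that(2)[of y]) auto
next
  case q_below
  with that(3) assms(2) Nset_disjoint show ?thesis by blast
next
  case below_own
  with that(1) show ?thesis by simp
qed

lemma Pless_pE:
  assumes "Pless k l elem_p"
  obtains x where "x \<in> Nset 0" "l = Node x"
  using assms by cases (use that in auto)

lemma not_Pless_Prime: "\<not> Pless k (Prime x) u"
  by (auto elim: Pless.cases)

text \<open>\<open>is_glb\<close> and \<open>is_lub\<close> do not require the set to lie in the carrier.\<close>

definition is_meet :: "nat \<Rightarrow> elem \<Rightarrow> elem \<Rightarrow> elem \<Rightarrow> bool" where
  "is_meet k m x y \<longleftrightarrow> {x, y} \<subseteq> carrier (Pposet k) \<and> is_glb (Pposet k) m {x, y}"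

definition is_join :: "nat \<Rightarrow> elem \<Rightarrow> elem \<Rightarrow> elem \<Rightarrow> bool" where
  "is_join k j x y \<longleftrightarrow> {x, y} \<subseteq> carrier (Pposet k) \<and> is_lub (Pposet k) j {x, y}"

section \<open>Meets and joins of pairs in the poset\<close>

lemma is_meetI:
  assumes "x \<in> carrier (Pposet k)" "y \<in> carrier (Pposet k)" "m \<in> carrier (Pposet k)"
    and "m = x \<or> Pless k m x" "m = y \<or> Pless k m y"
    and "\<And>l. l = x \<or> Pless k l x \<Longrightarrow> l = y \<or> Pless k l y \<Longrightarrow> l = m \<or> Pless k l m"
  shows "is_meet k m x y"
  using assms unfolding is_meet_def greatest_def Lower_def by (auto simp: Pposet_def)

lemma is_joinI:
  assumes "x \<in> carrier (Pposet k)" "y \<in> carrier (Pposet k)" "j \<in> carrier (Pposet k)"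
    and "x = j \<or> Pless k x j" "y = j \<or> Pless k y j"
    and "\<And>u. x = u \<or> Pless k x u \<Longrightarrow> y = u \<or> Pless k y u \<Longrightarrow> j = u \<or> Pless k j u"
  shows "is_join k j x y"
  using assms unfolding is_join_def least_def Upper_def by (auto simp: Pposet_def)

lemma Node_Pless_Prime: "n \<le> k \<Longrightarrow> x \<in> Nset n \<Longrightarrow> Pless k (Node x) (Prime x)"
  by (rule Pless.below_own) auto

lemma edge_Pless_Prime:
  assumes "n < k" "x \<in> Nset n" "y \<in> Nset n" "x \<noteq> y" "u \<in> {x, y}"
  shows "Pless k (Node (edge (Upair x y))) (Prime u)"
  using assms by (intro Pless.edge_below[of "Suc n"]) auto

lemma q_Pless_Prime: "x \<in> Nset k \<Longrightarrow> Pless k elem_q (Prime x)"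
  by (rule Pless.q_below) auto

lemma Node_carrier: "n \<le> k \<Longrightarrow> x \<in> Nset n \<Longrightarrow> Node x \<in> carrier (Pposet k)"
  and Prime_carrier: "n \<le> k \<Longrightarrow> x \<in> Nset n \<Longrightarrow> Prime x \<in> carrier (Pposet k)"
  using Node_Pless_Prime Pless_carrier by blast+

lemma p_carrier: "elem_p \<in> carrier (Pposet k)"
  and q_carrier: "elem_q \<in> carrier (Pposet k)"
  by (auto simp: Pposet_def)

text \<open>An edge at \<open>x\<close> and an edge at \<open>y\<close> coincide only if both join
  \<open>x\<close> to \<open>y\<close>; \<open>elem_q\<close> is excluded by
  \<open>n < k\<close>.\<close>

lemma is_meet_Primes_edge:
  assumes "n < k" "x \<in> Nset n" "y \<in> Nset n" "x \<noteq> y"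
  shows "is_meet k (Node (edge (Upair x y))) (Prime x) (Prime y)"
proof (rule is_meetI)
  have "edge (Upair x y) \<in> Nset (Suc n)"
    using assms by (intro edge_in_Nset)
  then show "Node (edge (Upair x y)) \<in> carrier (Pposet k)"
    using assms by (intro Node_carrier[of "Suc n"]) auto
  fix l
  assume "l = Prime x \<or> Pless k l (Prime x)" "l = Prime y \<or> Pless k l (Prime y)"
  then have lower: "Pless k l (Prime x)" "Pless k l (Prime y)"
    using assms not_Pless_Prime by auto
  show "l = Node (edge (Upair x y)) \<or> Pless k l (Node (edge (Upair x y)))"
    using lower(1) assms(2)
  proof (cases rule: Pless_PrimeE)
    case 1
    with lower(2) assms edge_neq[of y n _ x] show ?thesis
      by (auto elim!: Pless_PrimeE[OF _ assms(3)])
  next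
    case (2 z)
    with lower(2) assms edge_neq[of x n z y] show ?thesis
      by (auto elim!: Pless_PrimeE[OF _ assms(3)])
  next
    case 3
    with assms show ?thesis by simp
  qed
qed (use assms Prime_carrier[of n k] edge_Pless_Prime[of n k] in auto)

text \<open>Edges over the top level are not in the poset, so \<open>elem_q\<close> is the only
  element below both.\<close>

lemma is_meet_Primes_q:
  assumes "x \<in> Nset k" "y \<in> Nset k" "x \<noteq> y"
  shows "is_meet k elem_q (Prime x) (Prime y)"
proof (rule is_meetI)
  fix l
  assume "l = Prime x \<or> Pless k l (Prime x)" "l = Prime y \<or> Pless k l (Prime y)"
  then have "Pless k l (Prime x)" "Pless k l (Prime y)"
    using assms not_Pless_Prime by auto
  then show "l = elem_q \<or> Pless k l elem_q"
    using assms(3) by (auto elim!: Pless_PrimeE[OF _ assms(1)] Pless_PrimeE[OF _ assms(2)])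
qed (use assms Prime_carrier[of k k] q_carrier q_Pless_Prime in auto)

text \<open>Levels rule out any other lower bound: edges at \<open>?e\<close> have level
  \<open>n + 2\<close>, nodes below \<open>Prime x\<close> have level \<open>n\<close> or
  \<open>n + 1\<close>, and \<open>elem_q\<close> is below primed elements of level \<open>k\<close>
  only.\<close>

lemma is_meet_edge_Prime:
  assumes "n < k" "x \<in> Nset n" "y \<in> Nset n" "x \<noteq> y"
  shows "is_meet k (Node (edge (Upair x y))) (Prime (edge (Upair x y))) (Prime x)"
    (is "is_meet _ (Node ?e) _ _")
proof (rule is_meetI)
  have e: "?e \<in> Nset (Suc n)"
    using assms by (intro edge_in_Nset)
  show "Node ?e \<in> carrier (Pposet k)" "Prime ?e \<in> carrier (Pposet k)"
    "Node ?e = Prime ?e \<or> Pless k (Node ?e) (Prime ?e)"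
    using assms e Node_carrier[of "Suc n"] Prime_carrier[of "Suc n"] Node_Pless_Prime[of "Suc n"]
    by auto
  fix l
  assume "l = Prime ?e \<or> Pless k l (Prime ?e)" "l = Prime x \<or> Pless k l (Prime x)"
  moreover have "?e \<noteq> x"
    using e assms Nset_disjoint by (metis n_not_Suc_n)
  ultimately have l: "Pless k l (Prime ?e)" "Pless k l (Prime x)"
    using not_Pless_Prime by auto
  from l(1) e show "l = Node ?e \<or> Pless k l (Node ?e)"
  proof (cases rule: Pless_PrimeE)
    case (2 z)
    then have level: "edge (Upair ?e z) \<in> Nset (Suc (Suc n))"
      using edge_in_Nset[OF e] by blast
    have not_x: "edge (Upair ?e z) \<noteq> x"
      using level Nset_disjoint[OF assms(2), of "Suc (Suc n)"] by auto
    have not_edge: "edge (Upair ?e z) \<noteq> edge (Upair x w)" if "w \<in> Nset n" "x \<noteq> w" for w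
      using level Nset_disjoint[OF edge_in_Nset[OF assms(2) that], of "Suc (Suc n)"]
      by (metis n_not_Suc_n)
    from l(2) assms(2) show ?thesis
      by (cases rule: Pless_PrimeE) (use 2 not_x not_edge in \<open>metis elem.inject(1) elem.distinct\<close>)+
  next
    case 3
    with l(2) show ?thesis by (auto elim!: Pless_PrimeE[OF _ assms(2)])
  qed auto
qed (use assms Prime_carrier[of n k] edge_Pless_Prime[of n k] in auto)

text \<open>Only nodes of level 0 lie below \<open>elem_p\<close>, and edges are not among
  them.\<close>

lemma is_meet_Prime_p:
  assumes "x \<in> Nset 0"
  shows "is_meet k (Node x) (Prime x) elem_p"
proof (rule is_meetI)
  fix l
  assume "l = Prime x \<or> Pless k l (Prime x)" "l = elem_p \<or> Pless k l elem_p"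
  then have "Pless k l (Prime x)" "Pless k l elem_p"
    by (auto simp: not_Pless_Prime elim: Pless_pE elim!: Pless_PrimeE[OF _ assms])
  then show "l = Node x \<or> Pless k l (Node x)"
    using edge_neq[OF assms]
    by (auto elim!: Pless_PrimeE[OF _ assms] Pless_pE simp del: Nset.simps)
qed (use assms Prime_carrier[of 0 k] Node_carrier[of 0 k] p_carrier Node_Pless_Prime[of 0 k]
     Pless.below_p in auto)

lemma is_join_Nodes_p:
  assumes "x \<in> Nset 0" "y \<in> Nset 0" "x \<noteq> y"
  shows "is_join k elem_p (Node x) (Node y)"
proof (rule is_joinI)
  fix u
  assume "Node x = u \<or> Pless k (Node x) u" "Node y = u \<or> Pless k (Node y) u"
  \<comment> \<open>A node of level 0 is not an edge, so nothing else can lie above it.\<close>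
  moreover have "u \<in> {elem_p, Prime v, Dprime v}" if "v \<in> Nset 0" "Pless k (Node v) u" for v
    using that(2,1) by cases auto
  ultimately show "elem_p = u \<or> Pless k elem_p u"
    using assms by auto
qed (use assms Node_carrier[of 0 k] p_carrier Pless.below_p in auto)

text \<open>\<open>G\<close> abstracts \<open>{x. t \<in> h x}\<close> for a representation \<open>h\<close> and a point \<open>t \<in> h p\<close>.\<close>

locale point_filter =
  fixes k :: nat and G :: "elem set"
  assumes up: "Pless k x y \<Longrightarrow> x \<in> G \<Longrightarrow> y \<in> G"
    and meet: "is_meet k m x y \<Longrightarrow> x \<in> G \<Longrightarrow> y \<in> G \<Longrightarrow> m \<in> G"
    and join: "is_join k j x y \<Longrightarrow> j \<in> G \<Longrightarrow> x \<in> G \<or> y \<in> G"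
    and p: "elem_p \<in> G"
begin

section \<open>Climbing to \<open>elem_q\<close> and descending again inside
  \<open>G\<close>\<close>

lemma Prime_mem: "n \<le> k \<Longrightarrow> x \<in> Nset n \<Longrightarrow> Node x \<in> G \<Longrightarrow> Prime x \<in> G"
  using up Node_Pless_Prime by blast

lemma edge_mem:
  assumes "n < k" "x \<in> Nset n" "y \<in> Nset n" "x \<noteq> y" "Node x \<in> G" "Node y \<in> G"
  shows "Node (edge (Upair x y)) \<in> G"
  using assms meet[OF is_meet_Primes_edge] Prime_mem by (meson less_imp_le)

text \<open>Three is the least positive count that reproduces itself: two nodes would give only one
  edge.\<close>

lemma three_nodes:
  assumes "n \<le> k"
  shows "\<exists>A \<subseteq> Nset n. card A = 3 \<and> Node ` A \<subseteq> G"
  using assms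
proof (induction n)
  case 0
  have or: "Node x \<in> G \<or> Node y \<in> G" if "x \<in> Nset 0" "y \<in> Nset 0" "x \<noteq> y" for x y
    using join[OF is_join_Nodes_p p] that by blast
  \<comment> \<open>At most one node of level 0 is missing from \<open>G\<close>; if none is, any
    \<open>w\<close> will do.\<close>
  have "\<exists>w \<in> Nset 0. Node ` (Nset 0 - {w}) \<subseteq> G"
  proof (cases "\<exists>w \<in> Nset 0. Node w \<notin> G")
    case True
    with or show ?thesis by blast
  next
    case False
    then show ?thesis by auto
  qed
  then obtain w where w: "w \<in> Nset 0" "Node ` (Nset 0 - {w}) \<subseteq> G" by blast
  then have "card (Nset 0 - {w}) = 3"
    by (subst card_Diff_singleton) auto
  with w(2) show ?case by blast
next
  case (Suc n)
  then obtain A where "A \<subseteq> Nset n" "card A = 3" "Node ` A \<subseteq> G"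
    using Suc_leD by blast
  then obtain x y z where neq: "x \<noteq> y" "y \<noteq> z" "x \<noteq> z"
    and xyz: "{x, y, z} \<subseteq> Nset n" "Node ` {x, y, z} \<subseteq> G"
    by (metis card_3_iff)
  let ?B = "{edge (Upair x y), edge (Upair y z), edge (Upair x z)}"
  have "?B \<subseteq> Nset (Suc n)"
    using neq xyz(1) by (simp add: edge_in_Nset del: Nset.simps)
  moreover have "card ?B = 3"
    using neq by auto
  moreover have "Node ` ?B \<subseteq> G"
    using neq xyz Suc.prems edge_mem[of n] by simp
  ultimately show ?case by blast
qed

lemma two_nodes:
  assumes "n \<le> k"
  obtains x y where "x \<in> Nset n" "y \<in> Nset n" "x \<noteq> y" "Node x \<in> G" "Node y \<in> G"
proof -
  obtain A where "A \<subseteq> Nset n" "card A = 3" "Node ` A \<subseteq> G"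
    using three_nodes[OF assms] by blast
  moreover from this obtain x y z where "A = {x, y, z}" "x \<noteq> y"
    by (metis card_3_iff)
  ultimately show thesis using that[of x y] by simp
qed

lemma q_mem: "elem_q \<in> G"
proof -
  obtain x y where "x \<in> Nset k" "y \<in> Nset k" "x \<noteq> y" "Node x \<in> G" "Node y \<in> G"
    by (rule two_nodes[OF order_refl])
  then show ?thesis
    using meet[OF is_meet_Primes_q] Prime_mem by blast
qed

lemma all_Primes_mem:
  assumes "n \<le> k" "x \<in> Nset n"
  shows "Prime x \<in> G"
  using assms
proof (induction n arbitrary: x rule: inc_induct)
  case base
  then show ?case using q_Pless_Prime q_mem up by blast
next
  case (step n)
  obtain y z where "y \<in> Nset n" "z \<in> Nset n" "y \<noteq> z" "Node y \<in> G" "Node z \<in> G"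
    using step.hyps by (auto intro: two_nodes[of n])
  \<comment> \<open>Of two distinct nodes, at least one differs from \<open>x\<close>.\<close>
  then obtain u where u: "u \<in> Nset n" "u \<noteq> x" "Node u \<in> G"
    by metis
  then have "Prime (edge (Upair u x)) \<in> G"
    using step by (intro step.IH edge_in_Nset)
  moreover have "Prime u \<in> G"
    using u step.hyps by (intro Prime_mem) auto
  ultimately have "Node (edge (Upair u x)) \<in> G"
    using meet[OF is_meet_edge_Prime] u step by blast
  then show ?case
    using up edge_Pless_Prime[of n k u x x] u step by blast
qed

lemma node_mem: "x \<in> Nset 0 \<Longrightarrow> Node x \<in> G"
  using meet[OF is_meet_Prime_p] all_Primes_mem[of 0] p by blast

end

section \<open>From points to the failure of injectivity\<close>

theorem corollary3p9:
  fixes k :: nat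
  shows "\<not> representable TYPE('x) |{..<3::nat}| (Pposet k)"
proof
  assume "representable TYPE('x) |{..<3::nat}| (Pposet k)"
  then obtain X :: "'x set" and F h where
    alg: "algebra X F" and h: "h \<in> carrier (Pposet k) \<rightarrow> F" and inj: "inj_on h (carrier (Pposet k))"
    and meets: "\<forall>S m. S \<subseteq> carrier (Pposet k) \<and> (finite S \<and> card S < 3) \<and>
        is_glb (Pposet k) m S \<longrightarrow> h m = X \<inter> \<Inter> (h ` S)"
    and joins: "\<forall>T j. T \<subseteq> carrier (Pposet k) \<and> (finite T \<and> card T < 3) \<and>
        is_lub (Pposet k) j T \<longrightarrow> h j = \<Union> (h ` T)"
    unfolding representable_def representable2_def card_of_less_lessThan
    by (elim exE conjE) (rule that)
  \<comment> \<open>This lets the factor \<open>X\<close> in the condition on meets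
    disappear.\<close>
  have sub: "h x \<subseteq> X" if "x \<in> carrier (Pposet k)" for x
    using alg h that by (auto simp: algebra_iff_Un)
  have card: "finite {x, y} \<and> card {x, y} < 3" for x y :: elem
    by (simp add: card_insert_if)
  have meet: "h m = h x \<inter> h y" if "is_meet k m x y" for m x y
    using meets[rule_format, of "{x, y}" m] card sub[of x] that by (auto simp: is_meet_def)
  have join: "h j = h x \<union> h y" if "is_join k j x y" for j x y
    using joins[rule_format, of "{x, y}" j] card that by (auto simp: is_join_def)
  \<comment> \<open>Monotonicity is not demanded of a representation; it follows because the smaller
    of two comparable elements is their meet.\<close>
  have mono: "h x \<subseteq> h y" if "Pless k x y" for x y
  proof -
    have "is_meet k x x y"
      using that Pless_carrier by (intro is_meetI) blast+
    from meet[OF this] show ?thesis by blast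
  qed
  have "h elem_p \<subseteq> h (Node node_a)"
  proof
    fix t
    assume "t \<in> h elem_p"
    then interpret point_filter k "{x. t \<in> h x}"
      by unfold_locales (use mono meet join in blast)+
    show "t \<in> h (Node node_a)"
      using node_mem[of node_a] by simp
  qed
  moreover have "h (Node node_a) \<subseteq> h elem_p"
    by (intro mono Pless.below_p) simp
  ultimately have "h (Node node_a) = h elem_p" by blast
  then have "Node node_a = elem_p"
    by (rule inj_onD[OF inj]) (auto intro: Node_carrier[of 0] p_carrier)
  then show False by simp
qed

end
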